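(* Let $L\subset\mathbb{R}^n$ be a convex body and let $0\le\varepsilon<1$. If $m^*(L)\ge n-\varepsilon$, then $$d_{\rm BM}(L,\Delta)\le\frac{1}{1-\varepsilon},$$ where $d_{\rm BM}(L,\Delta)$ is the Banach--Mazur distance from $L$ to the $n$-simplex.
   Context: A convex body is a compact convex set with nonempty interior. For a convex body $L\subset\mathbb{R}^n$ and $o\in\operatorname{int}(L)$, $m_L(o):=\inf\{\alpha\ge 1:-(L-o)\subseteq\alpha(L-o)\}$, and the Minkowski measure of symmetry is $m^*(L):=\inf_{o\in\operatorname{int}(L)}m_L(o)$. For an $n$-dimensional simplex $S\subset\mathbb{R}^n$ let $\lambda_S(L):=\inf\{\lambda\ge 0:\exists x\in\mathbb{R}^n,\ L\subset x+\lambda S\}$, $\mu_S(L):=\sup\{\lambda\ge 0:\exists x\in\mathbb{R}^n,\ x+\lambda S\subseteq L\}$ and $d_S(L):=\lambda_S(L)/\mu_S(L)$. Then $d_{\rm BM}(L,\Delta):=\inf_S d_S(L)$, the infimum over all nondegenerate $n$-simplices $S\subset\mathbb{R}^n$ with barycenter $0$. *)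

theory Defs
  imports "HOL-Analysis.Analysis"
begin

definition convex_body :: "'a::euclidean_space set \<Rightarrow> bool" where
  "convex_body L \<longleftrightarrow> compact L \<and> convex L \<and> interior L \<noteq> {}"

definition asymmetry_at :: "'a::euclidean_space set \<Rightarrow> 'a \<Rightarrow> real" where
  "asymmetry_at L p =
    Inf {\<alpha>. 1 \<le> \<alpha> \<and> uminus ` ((\<lambda>x. x - p) ` L) \<subseteq> (\<lambda>x. \<alpha> *\<^sub>R x) ` ((\<lambda>x. x - p) ` L)}"

definition minkowski_symmetry :: "'a::euclidean_space set \<Rightarrow> real" where
  "minkowski_symmetry L = (INF p\<in>interior L. asymmetry_at L p)"

definition outer_scale :: "'a::euclidean_space set \<Rightarrow> 'a set \<Rightarrow> real" where
  "outer_scale S L = Inf {t. 0 \<le> t \<and> (\<exists>x. L \<subseteq> (\<lambda>y. x + t *\<^sub>R y) ` S)}"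

definition inner_scale :: "'a::euclidean_space set \<Rightarrow> 'a set \<Rightarrow> real" where
  "inner_scale S L = Sup {t. 0 \<le> t \<and> (\<exists>x. (\<lambda>y. x + t *\<^sub>R y) ` S \<subseteq> L)}"

definition scale_ratio :: "'a::euclidean_space set \<Rightarrow> 'a set \<Rightarrow> real" where
  "scale_ratio S L = outer_scale S L / inner_scale S L"

text \<open>The vertices of a simplex are its extreme points; the definition is only meant for
  simplices.\<close>

definition simplex_barycenter :: "'a::euclidean_space set \<Rightarrow> 'a" where
  "simplex_barycenter S =
    (1 / real (card {v. v extreme_point_of S})) *\<^sub>R (\<Sum>v | v extreme_point_of S. v)"

text \<open>The library predicate \<open>n simplex S\<close> requires affinely independent vertices, so with
  \<open>n\<close> the dimension of the space it describes exactly the nondegenerate full-dimensional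
  simplices.\<close>

definition BM_dist_simplex :: "'a::euclidean_space set \<Rightarrow> real" where
  "BM_dist_simplex L =
    Inf {scale_ratio S L | S. int DIM('a) simplex S \<and> simplex_barycenter S = 0}"

end

theory Submission
  imports Defs
begin

text \<open>
  Let \<open>n\<close> be the dimension and take any \<open>\<alpha> > 0\<close> below the Minkowski measure of symmetry of \<open>L\<close>.
  No point \<open>p\<close> satisfies \<open>-(L - p) \<subseteq> \<alpha> (L - p)\<close>. Written out, this says that the homothets \<open>x + \<alpha> L\<close>
  with \<open>x \<in> L\<close> have no common point, as \<open>(1 + \<alpha>) p\<close> would be one. By compactness and Helly's theorem, already
  \<open>n + 1\<close> of them, \<open>q\<^sub>k + \<alpha> L\<close>, have empty intersection.

  Separating these \<open>n + 1\<close> bodies simultaneously gives vectors \<open>u\<^sub>k\<close> with sum \<open>0\<close>. Let \<open>h\<^sub>k\<close> be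
  the maximum of \<open>u\<^sub>k\<close> on \<open>L\<close> and \<open>H\<close> the sum of the \<open>h\<^sub>k\<close>. The affine functions
  \<open>b\<^sub>k(x) = (h\<^sub>k - u\<^sub>k \<bullet> x) / H\<close> are nonnegative on \<open>L\<close> and add up to \<open>1\<close>, like the
  barycentric coordinates of a simplex around \<open>L\<close>. Separation amounts to saying that the
  stochastic matrix \<open>P\<close> with entries \<open>P\<^sub>j\<^sub>i = b\<^sub>i(q\<^sub>j)\<close> has trace greater than \<open>1 + \<alpha>\<close>. Hence, with \<open>\<alpha>\<close> close to
  \<open>n - \<epsilon>\<close>, the defect \<open>s = \<Sum>\<^sub>j (1 - P\<^sub>j\<^sub>j)\<close> is at most about \<open>\<epsilon>\<close>.

  It remains to find a homothet of that simplex, with ratio \<open>1 - s\<close>, inside the convex hull of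
  the \<open>q\<^sub>j\<close>. The right position has vertices with coordinate vectors \<open>r + (1 - s) e\<^sub>k\<close>, where \<open>r\<close> is
  the vector of off-diagonal column sums of \<open>P\<close>. That each of them is a convex
  combination of the rows of \<open>P\<close> is a fixed point statement on the standard simplex, provided
  by Brouwer's theorem (\<open>stochastic_matrix_hits_shifted_vertex\<close>). So \<open>L\<close> contains a
  simplex \<open>S\<close> and lies in a translate of \<open>(1 - s)\<^sup>-\<^sup>1 S\<close> (\<open>simplex_sandwich\<close>), and the distance is at
  most \<open>1 / (1 - s)\<close>. Letting \<open>\<alpha>\<close> tend to \<open>n - \<epsilon>\<close> gives the bound; an optimal centre of symmetry
  and its contact points are avoided altogether.
\<close>

section \<open>Homothets without a common point\<close>

text \<open>Helly's theorem for infinite families, in contrapositive form. The members with no common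
  point are indexed by a type with \<open>DIM('a) + 1\<close> elements, repetitions allowed, so that later
  sums and product spaces run over that type and the case of a smaller empty subfamily is
  included.\<close>

lemma family_empty_INT_Helly:
  fixes F :: "'b \<Rightarrow> 'a::euclidean_space set"
  assumes I: "I \<noteq> {}" and cpt: "\<And>i. i \<in> I \<Longrightarrow> compact (F i)"
    and cvx: "\<And>i. i \<in> I \<Longrightarrow> convex (F i)"
    and empty: "(\<Inter>i\<in>I. F i) = {}"
    and card: "CARD('k::finite) = DIM('a) + 1"
  shows "\<exists>g::'k \<Rightarrow> 'b. range g \<subseteq> I \<and> (\<Inter>k. F (g k)) = {}"
proof -
  obtain \<G> where \<G>: "finite \<G>" "\<G> \<subseteq> F ` I" "\<Inter>\<G> = {}"
    using compact_fip_Heine_Borel[of "F ` I"] cpt empty by blast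
  obtain T where T: "T \<subseteq> \<G>" "card T \<le> DIM('a) + 1" "\<Inter>T = {}"
  proof (cases "card \<G> \<ge> DIM('a) + 1")
    case True
    have "\<forall>s\<in>\<G>. convex s" using \<G> cvx by auto
    then obtain T where "T \<subseteq> \<G>" "card T = DIM('a) + 1" "\<Inter>T = {}"
      using Helly[OF True] \<G>(3) by blast
    then show ?thesis using that by auto
  next
    case False
    then show ?thesis using that[of \<G>] \<G> by auto
  qed
  have finT: "finite T" using T \<G> finite_subset by blast
  obtain t0 where t0: "t0 \<in> T" using T(3) by fastforce
  have "card T \<le> card (UNIV :: 'k set)" using T card by simp
  then obtain e :: "_ \<Rightarrow> 'k" where e: "inj_on e T"
    using card_le_inj[OF finT, of "UNIV :: 'k set"] by auto
  \<comment> \<open>A surjection from the index type onto \<open>T\<close>; surplus indices go to \<open>t0\<close>.\<close>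
  define s where "s k = (if k \<in> e ` T then inv_into T e k else t0)" for k
  have sT: "s k \<in> T" for k
    unfolding s_def using t0 by (auto intro: inv_into_into)
  have "\<exists>k. s k = v" if "v \<in> T" for v
    using that e by (intro exI[of _ "e v"]) (auto simp: s_def)
  then have range_s: "range s = T" using sT by auto
  have "s k \<in> F ` I" for k using sT T(1) \<G>(2) by blast
  then have "\<forall>k. \<exists>i. i \<in> I \<and> F i = s k" by (metis imageE)
  then obtain g where g: "\<And>k. g k \<in> I" "\<And>k. F (g k) = s k" by metis
  have "(\<Inter>k. F (g k)) = \<Inter>(range s)" by (simp add: g)
  also have "\<dots> = {}" using T(3) range_s by simp
  finally have "(\<Inter>k. F (g k)) = {}" .
  moreover have "range g \<subseteq> I" using g(1) by auto
  ultimately show ?thesis by (intro exI[of _ g] conjI)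
qed

lemma asymmetry_at_le:
  assumes "1 \<le> \<alpha>" "uminus ` ((\<lambda>x. x - p) ` L) \<subseteq> (\<lambda>x. \<alpha> *\<^sub>R x) ` ((\<lambda>x. x - p) ` L)"
  shows "asymmetry_at L p \<le> \<alpha>"
  unfolding asymmetry_at_def
proof (rule cInf_lower)
  show "\<alpha> \<in> {\<alpha>. 1 \<le> \<alpha> \<and> uminus ` ((\<lambda>x. x - p) ` L) \<subseteq> (\<lambda>x. \<alpha> *\<^sub>R x) ` ((\<lambda>x. x - p) ` L)}"
    using assms by blast
qed (rule bdd_belowI[of _ 1], blast)

text \<open>The value \<open>Inf {}\<close> is one fixed real number, so a common lower bound exists whether or not
  some centre \<open>p\<close> admits no ratio \<open>\<alpha>\<close> at all.\<close>

lemma bdd_below_asymmetry_at: "bdd_below (range (asymmetry_at L))"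
proof (rule bdd_belowI2[of _ "min 1 (Inf {})"])
  fix p
  let ?A = "{\<alpha>. 1 \<le> \<alpha> \<and> uminus ` ((\<lambda>x. x - p) ` L) \<subseteq> (\<lambda>x. \<alpha> *\<^sub>R x) ` ((\<lambda>x. x - p) ` L)}"
  show "min 1 (Inf {}) \<le> asymmetry_at L p"
  proof (cases "?A = {}")
    case True
    then show ?thesis unfolding asymmetry_at_def True by simp
  next
    case False
    then have "1 \<le> Inf ?A" by (intro cInf_greatest) auto
    then show ?thesis unfolding asymmetry_at_def by linarith
  qed
qed

text \<open>A common point \<open>z\<close> gives the centre \<open>p = z / (1 + \<alpha>)\<close> with \<open>-(L - p) \<subseteq> \<alpha> (L - p)\<close>. This is
  impossible for \<open>\<alpha> < 1\<close>, because a point of \<open>L\<close> farthest from \<open>p\<close> would be reflected to one that is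
  too far away; for \<open>\<alpha> \<ge> 1\<close> it bounds the Minkowski measure by \<open>\<alpha>\<close>. The case \<open>\<alpha> < 1\<close> is what
  occurs in dimension one.\<close>

lemma INT_homothets_eq_empty:
  fixes L :: "'a::euclidean_space set"
  assumes L: "convex_body L" and \<alpha>: "0 < \<alpha>" "\<alpha> < 1 \<or> \<alpha> < minkowski_symmetry L"
  shows "(\<Inter>x\<in>L. (\<lambda>y. x + \<alpha> *\<^sub>R y) ` L) = {}"
proof (rule ccontr)
  assume "\<not> ?thesis"
  then obtain z where z: "\<And>x. x \<in> L \<Longrightarrow> \<exists>y\<in>L. z = x + \<alpha> *\<^sub>R y" by blast
  define p where "p = (1 / (1 + \<alpha>)) *\<^sub>R z"
  have zp: "z = (1 + \<alpha>) *\<^sub>R p" using \<alpha> by (simp add: p_def)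
  have opp: "\<exists>y\<in>L. p - x = \<alpha> *\<^sub>R (y - p)" if x: "x \<in> L" for x
  proof -
    obtain y where "y \<in> L" "(1 + \<alpha>) *\<^sub>R p = x + \<alpha> *\<^sub>R y" using z[OF x] unfolding zp by auto
    then show ?thesis by (intro bexI[of _ y]) (auto simp: algebra_simps)
  qed
  have cpt: "compact L" and cvx: "convex L" and "interior L \<noteq> {}"
    using L by (auto simp: convex_body_def)
  then obtain a where a: "a \<in> interior L" by auto
  show False
  proof (cases "\<alpha> < 1")
    case True
    have "compact ((\<lambda>x. norm (x - p)) ` L)"
      by (intro compact_continuous_image continuous_intros cpt)
    moreover have "(\<lambda>x. norm (x - p)) ` L \<noteq> {}" using a interior_subset by auto
    ultimately obtain m where m: "m \<in> L" "\<And>x. x \<in> L \<Longrightarrow> norm (x - p) \<le> norm (m - p)"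
      using compact_attains_sup[of "(\<lambda>x. norm (x - p)) ` L"] by auto
    obtain y where y: "y \<in> L" "p - m = \<alpha> *\<^sub>R (y - p)" using opp[OF m(1)] by auto
    have "norm (m - p) = \<alpha> * norm (y - p)"
      using arg_cong[OF y(2), of norm] \<alpha> by (simp add: norm_minus_commute)
    also have "\<dots> \<le> \<alpha> * norm (m - p)" using m(2)[OF y(1)] \<alpha> by simp
    finally have "(1 - \<alpha>) * norm (m - p) \<le> 0" by (simp add: left_diff_distrib)
    then have "norm (m - p) = 0" using True by (simp add: mult_le_0_iff)
    then have "L \<subseteq> {p}" using m(2) by fastforce
    then have "interior L = {}"
      using interior_mono[of L "{p}"] by simp
    then show False using a by simp
  next
    case False
    \<comment> \<open>\<open>p\<close> lies strictly between the interior point \<open>a\<close> and \<open>y \<in> L\<close>, hence is itself interior.\<close>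
    obtain y where y: "y \<in> L" "p - a = \<alpha> *\<^sub>R (y - p)" using opp a interior_subset by blast
    have "(1 + \<alpha>) *\<^sub>R p = a + \<alpha> *\<^sub>R y"
      using y(2) by (simp add: algebra_simps)
    then have "(1 / (1 + \<alpha>)) *\<^sub>R (1 + \<alpha>) *\<^sub>R p = (1 / (1 + \<alpha>)) *\<^sub>R (a + \<alpha> *\<^sub>R y)"
      by simp
    then have "p = (1 / (1 + \<alpha>)) *\<^sub>R (a + \<alpha> *\<^sub>R y)" using \<alpha> by simp
    also have "\<dots> = y - (1 / (1 + \<alpha>)) *\<^sub>R (y - a)"
    proof -
      have "1 - 1 / (1 + \<alpha>) = \<alpha> / (1 + \<alpha>)" using \<alpha> by (simp add: field_simps)
      then have "(\<alpha> / (1 + \<alpha>)) *\<^sub>R y = y - (1 / (1 + \<alpha>)) *\<^sub>R y"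
        by (metis scaleR_left_diff_distrib scaleR_one)
      then show ?thesis by (simp add: algebra_simps)
    qed
    also have "\<dots> \<in> interior L"
      using \<alpha> y(1) a cvx by (intro mem_interior_convex_shrink) (auto simp: field_simps)
    finally have p: "p \<in> interior L" .
    have "uminus ` ((\<lambda>x. x - p) ` L) \<subseteq> (\<lambda>x. \<alpha> *\<^sub>R x) ` ((\<lambda>x. x - p) ` L)"
      using opp by force
    then have "asymmetry_at L p \<le> \<alpha>" using False by (intro asymmetry_at_le) auto
    moreover have "minkowski_symmetry L \<le> asymmetry_at L p"
      unfolding minkowski_symmetry_def
      using p bdd_below_asymmetry_at[of L] by (intro cINF_lower) (auto intro: bdd_below_mono)
    ultimately show False using \<alpha> False by linarith
  qed
qed

section \<open>Separation of several convex bodies\<close>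

text \<open>In the product space, the product of the \<open>A k\<close> misses the diagonal, so a hyperplane separates
  the two. A linear functional bounded above on the diagonal vanishes there, which means that its
  components add up to zero.\<close>

lemma separating_functionals_empty_INT:
  fixes A :: "'k::finite \<Rightarrow> 'a::euclidean_space set"
  assumes cvx: "\<And>k. convex (A k)" and cpt: "\<And>k. compact (A k)" and ne: "\<And>k. A k \<noteq> {}"
    and empty: "(\<Inter>k. A k) = {}"
  shows "\<exists>u. (\<Sum>k\<in>UNIV. u k) = 0 \<and>
    (\<forall>a. (\<forall>k. a k \<in> A k) \<longrightarrow> (\<Sum>k\<in>UNIV. u k \<bullet> a k) < 0)"
proof -
  define D :: "('a ^ 'k) set" where "D = range (\<lambda>x. \<chi> k. x)"
  define B :: "('a ^ 'k) set" where "B = {a. \<forall>k. a $ k \<in> A k}"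
  have subD: "subspace D"
    unfolding D_def
    by (intro linear_subspace_image subspace_UNIV linearI) (auto simp: vec_eq_iff)
  have "convex B"
    unfolding B_def convex_def using cvx by (auto simp: convex_def)
  moreover have "compact B"
  proof -
    have "closed ((\<lambda>a::'a ^ 'k. a $ k) -` A k)" for k
      by (intro closed_vimage compact_imp_closed cpt continuous_intros)
    moreover have "B = (\<Inter>k. (\<lambda>a. a $ k) -` A k)" by (auto simp: B_def)
    ultimately have "closed B" by auto
    moreover have "bounded B"
    proof -
      have "\<exists>M. \<forall>a\<in>A k. norm a \<le> M" for k
        using compact_imp_bounded[OF cpt] by (simp add: bounded_iff)
      then obtain M where M: "\<And>k a. a \<in> A k \<Longrightarrow> norm a \<le> M k" by metis
      have "norm x \<le> (\<Sum>k\<in>UNIV. M k)" if "x \<in> B" for x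
      proof -
        have "norm x \<le> (\<Sum>k\<in>UNIV. norm (x $ k))"
          unfolding norm_vec_def by (intro L2_set_le_sum) auto
        also have "\<dots> \<le> (\<Sum>k\<in>UNIV. M k)"
          using M that by (intro sum_mono) (auto simp: B_def)
        finally show ?thesis .
      qed
      then show ?thesis by (auto simp: bounded_iff)
    qed
    ultimately show ?thesis by (simp add: compact_eq_bounded_closed)
  qed
  moreover have "B \<noteq> {}"
  proof -
    obtain a where "\<And>k. a k \<in> A k" using ne by (meson all_not_in_conv)
    then have "(\<chi> k. a k) \<in> B" by (simp add: B_def)
    then show ?thesis by auto
  qed
  moreover have "D \<inter> B = {}"
    using empty by (auto simp: D_def B_def set_eq_iff)
  ultimately obtain U b where U: "\<And>x. x \<in> D \<Longrightarrow> U \<bullet> x < b" "\<And>x. x \<in> B \<Longrightarrow> U \<bullet> x > b"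
    using separating_hyperplane_closed_compact[of D B] subD
      closed_subspace subspace_imp_convex by blast
  have b: "b > 0" using U(1)[OF subspace_0[OF subD]] by simp
  have U0: "U \<bullet> x = 0" if "x \<in> D" for x
  proof (rule ccontr)
    assume "U \<bullet> x \<noteq> 0"
    then have "U \<bullet> ((b / (U \<bullet> x)) *\<^sub>R x) = b" by simp
    then show False using U(1) subspace_scale[OF subD that] by (metis less_irrefl)
  qed
  have "(\<Sum>k\<in>UNIV. U $ k) \<bullet> x = 0" for x
    using U0[of "\<chi> k. x"] by (simp add: D_def inner_vec_def inner_sum_left)
  then have "(\<Sum>k\<in>UNIV. U $ k) = 0" using inner_eq_zero_iff by blast
  moreover have "(\<Sum>k\<in>UNIV. (- U $ k) \<bullet> a k) < 0" if "\<forall>k. a k \<in> A k" for a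
    using U(2)[of "\<chi> k. a k"] that b by (simp add: B_def inner_vec_def sum_negf)
  ultimately show ?thesis
    by (intro exI[of _ "\<lambda>k. - U $ k"]) (auto simp: sum_negf)
qed

text \<open>The functionals separating the homothets are turned into affine functions that sum to one.
  Evaluating the separation at the points \<open>q k + \<alpha> m k\<close>, where \<open>m k\<close> maximises \<open>u k\<close> on \<open>L\<close>, gives
  \<open>(\<Sum>k. u k \<bullet> q k) < - \<alpha> H\<close>, which after division by \<open>H\<close> is the claim about the trace.\<close>

lemma barycentric_coordinates_large_trace:
  fixes L :: "'a::euclidean_space set" and q :: "'k::finite \<Rightarrow> 'a"
  assumes L: "compact L" "convex L" and q: "\<And>k. q k \<in> L" and \<alpha>: "0 < \<alpha>"
    and empty: "(\<Inter>k. (\<lambda>y. q k + \<alpha> *\<^sub>R y) ` L) = {}"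
  shows "\<exists>\<beta> u. (\<Sum>k\<in>UNIV. \<beta> k) = 1 \<and> (\<Sum>k\<in>UNIV. u k) = 0 \<and>
    (\<forall>k. \<forall>x\<in>L. 0 \<le> \<beta> k - u k \<bullet> x) \<and> 1 + \<alpha> < (\<Sum>k\<in>UNIV. \<beta> k - u k \<bullet> q k)"
proof -
  have "convex ((\<lambda>y. q k + \<alpha> *\<^sub>R y) ` L)" "compact ((\<lambda>y. q k + \<alpha> *\<^sub>R y) ` L)" for k
    using L by (auto intro: convex_affinity compact_affinity)
  then obtain u where u: "(\<Sum>k\<in>UNIV. u k) = 0"
    and neg: "\<And>a. (\<And>k. a k \<in> (\<lambda>y. q k + \<alpha> *\<^sub>R y) ` L) \<Longrightarrow> (\<Sum>k\<in>UNIV. u k \<bullet> a k) < 0"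
    using separating_functionals_empty_INT[of "\<lambda>k. (\<lambda>y. q k + \<alpha> *\<^sub>R y) ` L"] q empty by blast
  have "\<exists>m\<in>L. \<forall>x\<in>L. u k \<bullet> x \<le> u k \<bullet> m" for k
    using L q by (intro continuous_attains_sup continuous_intros) auto
  then obtain m where m: "\<And>k. m k \<in> L" "\<And>k x. x \<in> L \<Longrightarrow> u k \<bullet> x \<le> u k \<bullet> m k" by metis
  define H where "H = (\<Sum>k\<in>UNIV. u k \<bullet> m k)"
  have "(\<Sum>k\<in>UNIV. u k \<bullet> (q k + \<alpha> *\<^sub>R m k)) < 0"
    using m by (intro neg) auto
  then have ineq: "(\<Sum>k\<in>UNIV. u k \<bullet> q k) + \<alpha> * H < 0"
    by (simp add: H_def inner_add_right sum.distrib sum_distrib_left)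
  have sum_slack: "(\<Sum>k\<in>UNIV. u k \<bullet> m k - u k \<bullet> x) = H" for x
    using u by (simp add: H_def sum_subtractf flip: inner_sum_left)
  \<comment> \<open>If \<open>H\<close> vanished, all slacks would vanish on \<open>L\<close>; at the \<open>q k\<close> this contradicts \<open>ineq\<close>.\<close>
  have "0 < H"
  proof (rule ccontr)
    assume "\<not> 0 < H"
    moreover have "(\<Sum>k\<in>UNIV. u k \<bullet> q k) \<le> H" using m q by (auto simp: H_def intro: sum_mono)
    moreover have "H \<ge> 0" using sum_slack[of "q undefined"] m q
      by (metis (no_types, lifting) diff_ge_0_iff_ge sum_nonneg)
    ultimately have H0: "H = 0" by simp
    have "u k \<bullet> m k - u k \<bullet> x = 0" if "x \<in> L" for k x
      using sum_slack[of x] H0 m(2)[OF that]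
        sum_nonneg_eq_0_iff[of UNIV "\<lambda>k. u k \<bullet> m k - u k \<bullet> x"] by simp
    then have "u k \<bullet> q k = u k \<bullet> m k" for k
      using q by (metis eq_iff_diff_eq_0)
    then have "(\<Sum>k\<in>UNIV. u k \<bullet> q k) = H" by (simp add: H_def)
    then show False using ineq H0 by simp
  qed
  define \<beta> v where "\<beta> k = (u k \<bullet> m k) / H" and "v k = (1 / H) *\<^sub>R u k" for k
  have "(\<Sum>k\<in>UNIV. \<beta> k) = 1"
    using \<open>0 < H\<close> unfolding \<beta>_def sum_divide_distrib[symmetric] H_def[symmetric] by simp
  moreover have "(\<Sum>k\<in>UNIV. v k) = 0"
    using u by (simp add: v_def flip: scaleR_sum_right)
  moreover have "0 \<le> \<beta> k - v k \<bullet> x" if "x \<in> L" for k x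
    using m(2)[OF that] \<open>0 < H\<close> by (simp add: \<beta>_def v_def flip: diff_divide_distrib)
  moreover have "1 + \<alpha> < (\<Sum>k\<in>UNIV. \<beta> k - v k \<bullet> q k)"
  proof -
    have "(\<Sum>k\<in>UNIV. \<beta> k - v k \<bullet> q k) = (H - (\<Sum>k\<in>UNIV. u k \<bullet> q k)) / H"
    proof -
      have "(\<Sum>k\<in>UNIV. \<beta> k - v k \<bullet> q k) = (\<Sum>k\<in>UNIV. (u k \<bullet> m k - u k \<bullet> q k) / H)"
        by (simp add: \<beta>_def v_def diff_divide_distrib)
      also have "\<dots> = (\<Sum>k\<in>UNIV. u k \<bullet> m k - u k \<bullet> q k) / H"
        by (rule sum_divide_distrib[symmetric])
      finally show ?thesis by (simp add: H_def sum_subtractf)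
    qed
    moreover have "(1 + \<alpha>) * H < H - (\<Sum>k\<in>UNIV. u k \<bullet> q k)"
      using ineq by (simp add: algebra_simps)
    ultimately show ?thesis using \<open>0 < H\<close> by (simp add: pos_less_divide_eq)
  qed
  ultimately show ?thesis by blast
qed

section \<open>A homothet of the simplex among the chosen points\<close>

text \<open>With \<open>R\<close> the off-diagonal part of \<open>P\<close>, the required equation \<open>x P = 1 R + (1 - s) e\<^sub>k\<close> can be
  rewritten as \<open>x = (1 - x) R + (1 - s) e\<^sub>k + x (I - diag P)\<close>, where \<open>1\<close> stands for the all-ones vector.
  The right-hand side maps the standard simplex to itself: it is nonnegative since \<open>x \<le> 1\<close>
  there, and the mass \<open>(1 - x\<^sub>j) (1 - P\<^sub>j\<^sub>j)\<close> contributed by row \<open>j\<close> of the first term is completed to \<open>1 - P\<^sub>j\<^sub>j\<close> by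
  the last term, so that the total is \<open>s + (1 - s)\<close>. Brouwer's theorem applies.\<close>

lemma stochastic_matrix_hits_shifted_vertex:
  fixes P :: "'k::finite \<Rightarrow> 'k \<Rightarrow> real"
  assumes nn: "\<And>j i. 0 \<le> P j i" and row: "\<And>j. (\<Sum>i\<in>UNIV. P j i) = 1"
    and s: "(\<Sum>j\<in>UNIV. 1 - P j j) = s" "s \<le> 1"
  shows "\<exists>x. (\<forall>j. 0 \<le> x j) \<and> (\<Sum>j\<in>UNIV. x j) = 1 \<and>
    (\<forall>i. (\<Sum>j\<in>UNIV. x j * P j i) = (\<Sum>j\<in>UNIV-{i}. P j i) + (if i = k then 1 - s else 0))"
proof -
  define \<Delta> :: "(real ^ 'k) set" where "\<Delta> = {x. (\<forall>j. 0 \<le> x $ j) \<and> (\<Sum>j\<in>UNIV. x $ j) = 1}"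
  define R where "R j i = (if j = i then 0 else P j i)" for j i
  define f :: "real ^ 'k \<Rightarrow> real ^ 'k" where
    "f x = (\<chi> i. (\<Sum>j\<in>UNIV. (1 - x $ j) * R j i) + (if i = k then 1 - s else 0)
      + x $ i * (1 - P i i))" for x
  have R_row: "(\<Sum>i\<in>UNIV. R j i) = 1 - P j j" for j
    using row[of j] sum.remove[of UNIV j "P j"] sum.remove[of UNIV j "R j"]
    by (simp add: R_def)
  have R_nn: "0 \<le> R j i" for j i using nn by (simp add: R_def)
  have P_le: "P j i \<le> 1" for j i
    using row[of j] nn member_le_sum[of i UNIV "P j"] by simp
  have le1: "x $ j \<le> 1" if "x \<in> \<Delta>" for x j
    using that member_le_sum[of j UNIV "\<lambda>j. x $ j"] by (simp add: \<Delta>_def)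
  have "compact \<Delta>"
  proof -
    have "closed \<Delta>"
      unfolding \<Delta>_def
      by (intro closed_Collect_conj closed_Collect_all closed_Collect_le closed_Collect_eq continuous_intros)
    moreover have "\<Delta> \<subseteq> cbox 0 1"
      using le1 by (auto simp: mem_box_cart \<Delta>_def)
    ultimately show ?thesis
      by (metis bounded_cbox bounded_subset compact_eq_bounded_closed)
  qed
  moreover have "convex \<Delta>"
    by (auto simp: convex_def \<Delta>_def sum.distrib simp flip: sum_distrib_left)
  moreover have "\<Delta> \<noteq> {}"
  proof -
    have "axis k 1 \<in> \<Delta>" by (auto simp: \<Delta>_def axis_def)
    then show ?thesis by auto
  qed
  moreover have "continuous_on \<Delta> f"
    unfolding f_def by (intro continuous_intros)
  moreover have "f \<in> \<Delta> \<rightarrow> \<Delta>"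
  proof
    fix x assume x: "x \<in> \<Delta>"
    have "0 \<le> f x $ i" for i
      using x le1[OF x] R_nn P_le s(2)
      by (auto simp: f_def \<Delta>_def intro!: add_nonneg_nonneg sum_nonneg mult_nonneg_nonneg)
    moreover have "(\<Sum>i\<in>UNIV. f x $ i) = 1"
    proof -
      have "(\<Sum>i\<in>UNIV. \<Sum>j\<in>UNIV. (1 - x $ j) * R j i) = (\<Sum>j\<in>UNIV. (1 - x $ j) * (1 - P j j))"
        by (subst sum.swap) (simp add: R_row flip: sum_distrib_left)
      then have "(\<Sum>i\<in>UNIV. f x $ i)
          = (\<Sum>j\<in>UNIV. (1 - x $ j) * (1 - P j j)) + (1 - s) + (\<Sum>i\<in>UNIV. x $ i * (1 - P i i))"
        by (simp add: f_def sum.distrib)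
      also have "\<dots> = (\<Sum>j\<in>UNIV. (1 - x $ j) * (1 - P j j) + x $ j * (1 - P j j)) + (1 - s)"
        by (simp add: sum.distrib)
      also have "\<dots> = 1"
        using s(1) by (simp flip: distrib_right)
      finally show ?thesis .
    qed
    ultimately show "f x \<in> \<Delta>" by (simp add: \<Delta>_def)
  qed
  ultimately obtain x where x: "x \<in> \<Delta>" "f x = x" by (rule brouwer)
  have "(\<Sum>j\<in>UNIV. x $ j * P j i) = (\<Sum>j\<in>UNIV-{i}. P j i) + (if i = k then 1 - s else 0)" for i
  proof -
    have fi: "x $ i = (\<Sum>j\<in>UNIV. (1 - x $ j) * R j i) + (if i = k then 1 - s else 0) + x $ i * (1 - P i i)"
      using arg_cong[OF x(2), of "\<lambda>v. v $ i"] by (simp add: f_def)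
    have "(\<Sum>j\<in>UNIV. (1 - x $ j) * R j i) = (\<Sum>j\<in>UNIV-{i}. (1 - x $ j) * P j i)"
      using sum.remove[of UNIV i "\<lambda>j. (1 - x $ j) * R j i"] by (simp add: R_def)
    also have "\<dots> = (\<Sum>j\<in>UNIV-{i}. P j i) - (\<Sum>j\<in>UNIV-{i}. x $ j * P j i)"
      by (simp add: left_diff_distrib sum_subtractf)
    finally show ?thesis
      using fi sum.remove[of UNIV i "\<lambda>j. x $ j * P j i"] by (simp add: algebra_simps)
  qed
  then show ?thesis using x(1) by (intro exI[of _ "\<lambda>j. x $ j"]) (auto simp: \<Delta>_def)
qed

text \<open>The points \<open>y k\<close> with coordinates \<open>r + (1 - s) e\<^sub>k\<close> span a simplex inside \<open>L\<close>. Conversely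
  \<open>z \<in> L\<close> is compared with \<open>Y z = (\<Sum>k. b k z *\<^sub>R y k)\<close>, a point of that simplex with coordinates
  \<open>r + (1 - s) b(z)\<close>. Hence \<open>z - Y z / (1 - s)\<close> has the same value under all \<open>u k\<close>, whatever \<open>z\<close> is,
  and it is constant because the \<open>u k\<close> separate points.\<close>

lemma simplex_sandwich:
  fixes L :: "'a::euclidean_space set" and q :: "'k::finite \<Rightarrow> 'a"
  assumes card: "CARD('k) = DIM('a) + 1" and L: "convex L" and q: "\<And>j. q j \<in> L"
    and \<beta>: "(\<Sum>k\<in>UNIV. \<beta> k) = 1" and u: "(\<Sum>k\<in>UNIV. u k) = 0"
    and nn: "\<And>k x. x \<in> L \<Longrightarrow> 0 \<le> \<beta> k - u k \<bullet> x"
    and s: "(\<Sum>j\<in>UNIV. 1 - (\<beta> j - u j \<bullet> q j)) = s" "s < 1"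
  shows "\<exists>C c. \<not> affine_dependent C \<and> card C = DIM('a) + 1 \<and> convex hull C \<subseteq> L \<and>
    L \<subseteq> (\<lambda>y. c + (1 / (1 - s)) *\<^sub>R y) ` (convex hull C)"
proof -
  define b where "b k x = \<beta> k - u k \<bullet> x" for k x
  have b_nn: "0 \<le> b k x" if "x \<in> L" for k x using nn[OF that] by (simp add: b_def)
  have b_sum: "(\<Sum>k\<in>UNIV. b k x) = 1" for x
    using \<beta> u by (simp add: b_def sum_subtractf flip: inner_sum_left)
  \<comment> \<open>The second summand corrects for coefficient sums other than one: it is used with
    sum one (affine combinations) and with sum zero (affine dependences).\<close>
  have b_comb: "b i (\<Sum>k\<in>UNIV. c k *\<^sub>R y k) + \<beta> i * (sum c UNIV - 1) = (\<Sum>k\<in>UNIV. c k * b i (y k))"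
    for i and c :: "'k \<Rightarrow> real" and y
    by (simp add: b_def inner_sum_right right_diff_distrib sum_subtractf flip: sum_distrib_right)
  define r where "r i = (\<Sum>j\<in>UNIV-{i}. b i (q j))" for i
  have "\<exists>X. (\<forall>j. 0 \<le> X j) \<and> (\<Sum>j\<in>UNIV. X j) = 1 \<and>
      (\<forall>i. (\<Sum>j\<in>UNIV. X j * b i (q j)) = r i + (if i = k then 1 - s else 0))" for k
    unfolding r_def
    using stochastic_matrix_hits_shifted_vertex[of "\<lambda>j i. b i (q j)" s k] b_nn[OF q] b_sum s
    by (simp add: b_def)
  then obtain X where X: "\<And>k j. 0 \<le> X k j" "\<And>k. (\<Sum>j\<in>UNIV. X k j) = 1"
    "\<And>k i. (\<Sum>j\<in>UNIV. X k j * b i (q j)) = r i + (if i = k then 1 - s else 0)" by metis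
  define y where "y k = (\<Sum>j\<in>UNIV. X k j *\<^sub>R q j)" for k
  have y_L: "y k \<in> L" for k
    unfolding y_def using X q L by (intro convex_sum) auto
  have b_y: "b i (y k) = r i + (if i = k then 1 - s else 0)" for i k
    using b_comb[of i "X k" q] X by (simp add: y_def)
  have b_comb_y: "b i (\<Sum>k\<in>UNIV. c k *\<^sub>R y k) + \<beta> i * (sum c UNIV - 1) = r i * sum c UNIV + (1 - s) * c i"
    for i c
    unfolding b_comb b_y
    by (simp add: distrib_left sum.distrib sum_distrib_right if_distrib[of "\<lambda>t. _ * t"]
        mult.commute sum_distrib_left cong: if_cong)
  have inj: "inj y"
  proof (rule injI)
    fix k l assume "y k = y l"
    then have "b k (y k) = b k (y l)" by simp
    then show "k = l" using s(2) by (simp add: b_y split: if_splits)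
  qed
  define C where "C = range y"
  have finC: "finite C" by (simp add: C_def)
  have card_C: "card C = DIM('a) + 1"
    using inj card by (simp add: C_def card_image)
  have indep: "\<not> affine_dependent C"
  proof
    assume "affine_dependent C"
    then obtain U v where U: "sum U C = 0" "v \<in> C" "U v \<noteq> 0" "(\<Sum>v\<in>C. U v *\<^sub>R v) = 0"
      using affine_dependent_explicit_finite[OF finC] by auto
    obtain i where i: "v = y i" using U(2) by (auto simp: C_def)
    have 1: "(\<Sum>k\<in>UNIV. U (y k)) = 0" "(\<Sum>k\<in>UNIV. U (y k) *\<^sub>R y k) = 0"
      using U(1,4) unfolding C_def by (simp_all add: sum.reindex[OF inj] o_def)
    have "(1 - s) * U (y i) = 0"
      using b_comb_y[of i "\<lambda>k. U (y k)"] unfolding 1 by (simp add: b_def)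
    then show False using s(2) U(3) i by simp
  qed
  \<comment> \<open>The \<open>n + 1\<close> affinely independent points \<open>y k\<close> span the space, so \<open>y k + d\<close> is an affine
    combination of them. It has the same coordinates as \<open>y k\<close>, hence the same coefficients.\<close>
  have zero: "d = 0" if d: "\<And>i. u i \<bullet> d = 0" for d
  proof -
    define k :: 'k where "k = undefined"
    have "y k + d \<in> affine hull C"
      using affine_independent_span_eq[OF indep] card_C by simp
    then obtain w where w: "sum w C = 1" "(\<Sum>v\<in>C. w v *\<^sub>R v) = y k + d"
      using affine_hull_finite[OF finC] by auto
    have 1: "(\<Sum>k\<in>UNIV. w (y k)) = 1" "(\<Sum>k\<in>UNIV. w (y k) *\<^sub>R y k) = y k + d"
      using w unfolding C_def by (simp_all add: sum.reindex[OF inj] o_def)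
    have wi: "w (y i) = (if i = k then 1 else 0)" for i
    proof -
      have "b i (y k + d) = b i (y k)" using d by (simp add: b_def inner_add_right)
      then show ?thesis
        using b_comb_y[of i "\<lambda>k. w (y k)"] s(2) unfolding 1 by (auto simp: b_y split: if_splits)
    qed
    show ?thesis using 1(2) unfolding wi by (simp add: if_distrib[of "\<lambda>t. t *\<^sub>R _"] cong: if_cong)
  qed
  define Y where "Y z = (\<Sum>k\<in>UNIV. b k z *\<^sub>R y k)" for z
  have b_Y: "b i (Y z) = r i + (1 - s) * b i z" for i z
    using b_comb_y[of i "\<lambda>k. b k z"] by (simp add: Y_def b_sum)
  define c where "c = q undefined - (1 / (1 - s)) *\<^sub>R Y (q undefined)"
  have decomp: "z = c + (1 / (1 - s)) *\<^sub>R Y z" for z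
  proof -
    have "u i \<bullet> (z - (1 / (1 - s)) *\<^sub>R Y z - c) = 0" for i
    proof -
      have uY: "u i \<bullet> Y x = \<beta> i - r i - (1 - s) * (\<beta> i - u i \<bullet> x)" for x
        using b_Y[of i x] by (simp add: b_def)
      have "u i \<bullet> (x - (1 / (1 - s)) *\<^sub>R Y x) = \<beta> i - (\<beta> i - r i) / (1 - s)" for x
        using s(2) by (simp add: inner_diff_right uY diff_divide_distrib)
      then show ?thesis by (simp add: c_def inner_diff_right)
    qed
    then have "z - (1 / (1 - s)) *\<^sub>R Y z - c = 0" by (rule zero)
    then show ?thesis by (simp add: algebra_simps)
  qed
  have "Y z \<in> convex hull C" if "z \<in> L" for z
    unfolding Y_def using b_nn[OF that] b_sum
    by (intro convex_sum) (auto simp: C_def intro: hull_inc)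
  then have "L \<subseteq> (\<lambda>y. c + (1 / (1 - s)) *\<^sub>R y) ` (convex hull C)"
    using decomp by blast
  moreover have "convex hull C \<subseteq> L"
    using y_L L by (intro hull_minimal) (auto simp: C_def)
  ultimately show ?thesis using indep card_C by blast
qed

section \<open>From an inscribed simplex to the Banach--Mazur distance\<close>

text \<open>The next lemmas ensure that the supremum and the infima behind the distance are not taken
  over empty or unbounded sets, where their values would carry no meaning.\<close>

lemma scale_factors_bdd_above:
  fixes S L :: "'a::euclidean_space set"
  assumes L: "bounded L" and S: "a \<in> S" "b \<in> S" "a \<noteq> b"
  shows "bdd_above {t. 0 \<le> t \<and> (\<exists>x. (\<lambda>y. x + t *\<^sub>R y) ` S \<subseteq> L)}"
proof (rule bdd_aboveI[of _ "diameter L / dist a b"])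
  fix t assume "t \<in> {t. 0 \<le> t \<and> (\<exists>x. (\<lambda>y. x + t *\<^sub>R y) ` S \<subseteq> L)}"
  then obtain x where t: "0 \<le> t" "(\<lambda>y. x + t *\<^sub>R y) ` S \<subseteq> L" by auto
  have "dist (x + t *\<^sub>R a) (x + t *\<^sub>R b) \<le> diameter L"
    using t S L by (intro diameter_bounded_bound) auto
  also have "dist (x + t *\<^sub>R a) (x + t *\<^sub>R b) = t * dist a b"
    using t(1) by (simp add: dist_norm flip: scaleR_diff_right)
  finally show "t \<le> diameter L / dist a b" using S by (simp add: pos_le_divide_eq)
qed

lemma scaled_copy_covers:
  fixes S L :: "'a::euclidean_space set"
  assumes L: "bounded L" and S: "interior S \<noteq> {}"
  shows "\<exists>t\<ge>0. \<exists>x. L \<subseteq> (\<lambda>y. x + t *\<^sub>R y) ` S"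
proof -
  obtain a e where e: "e > 0" "cball a e \<subseteq> S"
    using S by (meson all_not_in_conv mem_interior_cball)
  obtain B where B: "B > 0" "\<And>x. x \<in> L \<Longrightarrow> norm x \<le> B"
    using L bounded_pos by blast
  have "x \<in> (\<lambda>y. - (B / e) *\<^sub>R a + (B / e) *\<^sub>R y) ` S" if "x \<in> L" for x
  proof
    show "x = - (B / e) *\<^sub>R a + (B / e) *\<^sub>R (a + (e / B) *\<^sub>R x)"
      using e B(1) by (simp add: algebra_simps)
    have "norm ((e / B) *\<^sub>R x) \<le> e"
      using B(1) B(2)[OF that] e by (simp add: field_simps)
    then show "a + (e / B) *\<^sub>R x \<in> S" using e(2) by (auto simp: dist_norm)
  qed
  moreover have "0 \<le> B / e" using B e by simp
  ultimately show ?thesis by blast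
qed

lemma full_simplex_interior:
  fixes S :: "'a::euclidean_space set"
  assumes "int DIM('a) simplex S"
  shows "interior S \<noteq> {}"
proof -
  obtain C where C: "\<not> affine_dependent C" "int (card C) = int DIM('a) + 1" "S = convex hull C"
    using assms by (auto simp: simplex_def)
  then have "card C = Suc DIM('a)" by linarith
  then show ?thesis using interior_convex_hull_eq_empty C by blast
qed

lemma interior_imp_two_points:
  fixes S :: "'a::euclidean_space set"
  assumes "interior S \<noteq> {}"
  shows "\<exists>a\<in>S. \<exists>b\<in>S. a \<noteq> b"
proof (rule ccontr)
  assume "\<not> ?thesis"
  moreover obtain a where "a \<in> S" using assms interior_subset by fastforce
  ultimately have "S = {a}" by blast
  then show False using assms by simp
qed

lemma scale_ratio_nonneg:
  fixes S L :: "'a::euclidean_space set"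
  assumes L: "bounded L" "L \<noteq> {}" and S: "int DIM('a) simplex S"
  shows "0 \<le> scale_ratio S L"
proof -
  have S': "interior S \<noteq> {}" using full_simplex_interior[OF S] .
  have "0 \<le> outer_scale S L"
    unfolding outer_scale_def using scaled_copy_covers[OF L(1) S'] by (intro cInf_greatest) auto
  moreover have "0 \<le> inner_scale S L"
  proof -
    obtain a b where ab: "a \<in> S" "b \<in> S" "a \<noteq> b"
      using interior_imp_two_points[OF S'] by blast
    obtain l where "l \<in> L" using L by auto
    then have "\<exists>x. (\<lambda>y. x + 0 *\<^sub>R y) ` S \<subseteq> L" by (intro exI[of _ l]) auto
    then show ?thesis
      unfolding inner_scale_def
      by (intro cSup_upper scale_factors_bdd_above[OF L(1) ab]) auto
  qed
  ultimately show ?thesis by (simp add: scale_ratio_def)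
qed

text \<open>The distance only admits simplices with barycenter zero, so the given simplex is first moved
  there by a translation, which changes no scale factor.\<close>

lemma BM_dist_simplex_le:
  fixes L :: "'a::euclidean_space set"
  assumes L: "bounded L" and C: "\<not> affine_dependent C" "card C = DIM('a) + 1"
    and inner: "convex hull C \<subseteq> L" and \<mu>: "0 \<le> \<mu>"
    and outer: "L \<subseteq> (\<lambda>y. c + \<mu> *\<^sub>R y) ` (convex hull C)"
  shows "BM_dist_simplex L \<le> \<mu>"
proof -
  define g where "g = (1 / real (card C)) *\<^sub>R (\<Sum>v\<in>C. v)"
  define S where "S = (\<lambda>x. - g + x) ` (convex hull C)"
  have finC: "finite C" using C(1) by (rule aff_independent_finite)
  have S: "S = convex hull ((\<lambda>x. - g + x) ` C)" unfolding S_def by (rule convex_hull_translation[symmetric])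
  have indep: "\<not> affine_dependent ((\<lambda>x. - g + x) ` C)"
    using C(1) affine_dependent_translation_eq by blast
  have card: "card ((\<lambda>x. - g + x) ` C) = DIM('a) + 1"
    using C(2) by (simp add: card_image)
  have simp: "int DIM('a) simplex S"
    unfolding simplex_def using indep card S by (intro exI[of _ "(\<lambda>x. - g + x) ` C"]) auto
  have "{v. v extreme_point_of S} = (\<lambda>x. - g + x) ` C"
    unfolding S extreme_point_of_convex_hull_affine_independent[OF indep] by simp
  moreover have "(\<Sum>v\<in>(\<lambda>x. - g + x) ` C. v) = 0"
  proof -
    have "(\<Sum>v\<in>(\<lambda>x. - g + x) ` C. v) = (\<Sum>v\<in>C. - g + v)" by (simp add: sum.reindex)
    also have "\<dots> = - (real (card C) *\<^sub>R g) + (\<Sum>v\<in>C. v)"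
      by (simp add: sum.distrib sum_subtractf sum_constant_scaleR)
    also have "\<dots> = 0" using C(2) by (simp add: g_def)
    finally show ?thesis .
  qed
  ultimately have bary: "simplex_barycenter S = 0" by (simp add: simplex_barycenter_def)
  have "L \<noteq> {}" using inner C(2) by auto
  have "outer_scale S L \<le> \<mu>"
  proof -
    have "(\<lambda>y. c + \<mu> *\<^sub>R y) ` (convex hull C) = (\<lambda>y. (c + \<mu> *\<^sub>R g) + \<mu> *\<^sub>R y) ` S"
      unfolding S_def image_image by (simp add: algebra_simps)
    then show ?thesis
      unfolding outer_scale_def using outer \<mu>
      by (intro cInf_lower bdd_belowI[of _ 0]) auto
  qed
  moreover have "1 \<le> inner_scale S L"
  proof -
    have "(\<lambda>y. g + 1 *\<^sub>R y) ` S \<subseteq> L"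
      unfolding S_def image_image using inner by simp
    then have "\<exists>x. (\<lambda>y. x + 1 *\<^sub>R y) ` S \<subseteq> L" by blast
    moreover obtain a b where ab: "a \<in> S" "b \<in> S" "a \<noteq> b"
      using interior_imp_two_points[OF full_simplex_interior[OF simp]] by blast
    ultimately show ?thesis
      unfolding inner_scale_def
      by (intro cSup_upper scale_factors_bdd_above[OF L ab]) auto
  qed
  ultimately have "scale_ratio S L \<le> \<mu> / 1"
    unfolding scale_ratio_def using \<mu> by (intro frac_le) auto
  moreover have "BM_dist_simplex L \<le> scale_ratio S L"
    unfolding BM_dist_simplex_def using simp bary scale_ratio_nonneg[OF L \<open>L \<noteq> {}\<close>]
    by (intro cInf_lower bdd_belowI[of _ 0]) auto
  ultimately show ?thesis by simp
qed

section \<open>Stability of the simplex\<close>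

theorem theorem5:
  fixes L :: "(real ^ 'n) set" and \<epsilon> :: real
  assumes "convex_body L"
    and "0 \<le> \<epsilon>" and "\<epsilon> < 1"
    and "minkowski_symmetry L \<ge> real CARD('n) - \<epsilon>"
  shows "BM_dist_simplex L \<le> 1 / (1 - \<epsilon>)"
proof (rule dense_ge)
  fix B assume B: "1 / (1 - \<epsilon>) < B"
  have "0 < 1 / (1 - \<epsilon>)" using assms by simp
  with B have B0: "0 < B" by linarith
  \<comment> \<open>The value for which a trace above \<open>1 + \<alpha>\<close> makes the final bound \<open>1 / (1 - s)\<close> less than \<open>B\<close>.\<close>
  define \<alpha> where "\<alpha> = real CARD('n) - 1 + 1 / B"
  have "1 / B < 1 - \<epsilon>" using B B0 assms by (simp add: field_simps)
  then have \<alpha>: "\<alpha> < minkowski_symmetry L" using assms by (simp add: \<alpha>_def)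
  have "1 \<le> CARD('n)" by (simp add: Suc_leI)
  then have \<alpha>0: "0 < \<alpha>" using B0 by (simp add: \<alpha>_def add_nonneg_pos)
  have L: "compact L" "convex L" "bounded L" "L \<noteq> {}"
    using assms(1) by (auto simp: convex_body_def compact_imp_bounded)
  have card: "CARD('n option) = DIM(real ^ 'n) + 1" by simp
  have "(\<Inter>x\<in>L. (\<lambda>y. x + \<alpha> *\<^sub>R y) ` L) = {}"
    using INT_homothets_eq_empty[OF assms(1) \<alpha>0] \<alpha> by blast
  then obtain q :: "'n option \<Rightarrow> real ^ 'n" where q: "range q \<subseteq> L"
    "(\<Inter>k. (\<lambda>y. q k + \<alpha> *\<^sub>R y) ` L) = {}"
    using family_empty_INT_Helly[of L "\<lambda>x. (\<lambda>y. x + \<alpha> *\<^sub>R y) ` L", OF L(4) _ _ _ card] L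
    by (auto simp: compact_affinity convex_affinity)
  have qL: "q k \<in> L" for k using q(1) by auto
  obtain \<beta> u where \<beta>u: "(\<Sum>k\<in>UNIV. \<beta> k) = 1" "(\<Sum>k\<in>UNIV. u k) = 0"
    "\<And>k x. x \<in> L \<Longrightarrow> 0 \<le> \<beta> k - u k \<bullet> x" and tr: "1 + \<alpha> < (\<Sum>k\<in>UNIV. \<beta> k - u k \<bullet> q k)"
    using barycentric_coordinates_large_trace[OF L(1,2) qL \<alpha>0 q(2)] by blast
  define s where "s = (\<Sum>k\<in>UNIV. 1 - (\<beta> k - u k \<bullet> q k))"
  have "s = real CARD('n option) - (\<Sum>k\<in>UNIV. \<beta> k - u k \<bullet> q k)"
    unfolding s_def by (simp add: sum_subtractf)
  then have s: "1 / B < 1 - s"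
    using tr by (simp add: \<alpha>_def)
  moreover have "0 < 1 / B" using B0 by simp
  ultimately have s1: "s < 1" by linarith
  obtain C c where "\<not> affine_dependent C" "card C = DIM(real ^ 'n) + 1" "convex hull C \<subseteq> L"
    "L \<subseteq> (\<lambda>y. c + (1 / (1 - s)) *\<^sub>R y) ` (convex hull C)"
    using simplex_sandwich[OF card L(2) qL \<beta>u s_def[symmetric] s1] by blast
  then have "BM_dist_simplex L \<le> 1 / (1 - s)"
    using s1 by (intro BM_dist_simplex_le[OF L(3)]) auto
  also have "\<dots> \<le> B" using s s1 B0 by (simp add: field_simps)
  finally show "BM_dist_simplex L \<le> B" .
qed

end
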